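(* Let $D,\tilde X,\tilde S,Q_x,Q_s\in\mathbb{R}^{m\times n}$, $L>0$ and $\delta\ge0$, and consider the problem $$(P_s):\ \min_{X,S\in\mathbb{R}^{m\times n}}\left\{\frac{L}{2}\left(\|X-\tilde X\|_F^2+\|S-\tilde S\|_F^2\right)+\langle Q_x,X\rangle+\langle Q_s,S\rangle:\ \|X+S-D\|_F\le\delta\right\}.$$ Let $q_x(X):=X-\frac1L Q_x$ and $q_s(S):=S-\frac1L Q_s$. The optimal solution $(X^*,S^* )$ to $(P_s)$ can be written in closed form as follows. When $\delta>0$, $$X^*=\left(\frac{\theta^*}{L+2\theta^*}\right)\left(D-q_s(\tilde S)\right)+\left(\frac{L+\theta^*}{L+2\theta^*}\right)q_x(\tilde X),$$ $$S^*=\left(\frac{\theta^*}{L+2\theta^*}\right)\left(D-q_x(\tilde X)\right)+\left(\frac{L+\theta^*}{L+2\theta^*}\right)q_s(\tilde S),$$ where $$\theta^*=\max\left\{0,\ \frac{L}{2}\left(\frac{\|q_x(\tilde X)+q_s(\tilde S)-D\|_F}{\delta}-1\right)\right\}.$$ When $\delta=0$, $$X^*=\frac12\left(D-q_s(\tilde S)\right)+\frac12 q_x(\tilde X)\quad\text{and}\quad S^*=\frac12\left(D-q_x(\tilde X)\right)+\frac12 q_s(\tilde S).$$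
   Context: $\|\cdot\|_F$ is the Frobenius norm and $\langle\cdot,\cdot\rangle$ the trace inner product on $\mathbb{R}^{m\times n}$. *)

theory Defs
  imports "HOL-Analysis.Analysis"
begin

text \<open>
  An m by n real matrix is an element of type \<open>real ^ 'n ^ 'm\<close>. The library's \<open>norm\<close> and inner
  product on this type are the Frobenius norm and the trace inner product, as the next two
  lemmas record. (The operator norm is the separate constant \<open>onorm\<close>.)
\<close>

lemma norm_matrix_eq_Frobenius:
  fixes A :: "real ^ 'n ^ 'm"
  shows "norm A = sqrt (\<Sum>i\<in>UNIV. \<Sum>j\<in>UNIV. (A $ i $ j)\<^sup>2)"
  by (simp add: norm_eq_sqrt_inner inner_vec_def power2_eq_square)

lemma inner_matrix_eq_trace:
  fixes A B :: "real ^ 'n ^ 'm"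
  shows "A \<bullet> B = trace (transpose A ** B)"
  unfolding trace_def transpose_def matrix_matrix_mult_def inner_vec_def
  by (simp, rule sum.swap)

definition Ps_objective ::
  "real \<Rightarrow> real ^ 'n ^ 'm \<Rightarrow> real ^ 'n ^ 'm \<Rightarrow> real ^ 'n ^ 'm \<Rightarrow> real ^ 'n ^ 'm
    \<Rightarrow> (real ^ 'n ^ 'm) \<times> (real ^ 'n ^ 'm) \<Rightarrow> real" where
  "Ps_objective L Xt St Qx Qs = (\<lambda>(X, S).
     L / 2 * ((norm (X - Xt))\<^sup>2 + (norm (S - St))\<^sup>2) + Qx \<bullet> X + Qs \<bullet> S)"

definition Ps_feasible ::
  "real ^ 'n ^ 'm \<Rightarrow> real \<Rightarrow> (real ^ 'n ^ 'm) \<times> (real ^ 'n ^ 'm) \<Rightarrow> bool" where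
  "Ps_feasible D \<delta> = (\<lambda>(X, S). norm (X + S - D) \<le> \<delta>)"

definition Ps_optimal ::
  "real ^ 'n ^ 'm \<Rightarrow> real \<Rightarrow> real \<Rightarrow> real ^ 'n ^ 'm \<Rightarrow> real ^ 'n ^ 'm \<Rightarrow> real ^ 'n ^ 'm
    \<Rightarrow> real ^ 'n ^ 'm \<Rightarrow> real ^ 'n ^ 'm \<Rightarrow> real ^ 'n ^ 'm \<Rightarrow> bool" where
  "Ps_optimal D \<delta> L Xt St Qx Qs X S \<longleftrightarrow>
     is_arg_min (Ps_objective L Xt St Qx Qs) (Ps_feasible D \<delta>) (X, S)"

text \<open>\<open>q_map L Qx\<close> and \<open>q_map L Qs\<close> are the maps $q_x$ and $q_s$.\<close>

definition q_map :: "real \<Rightarrow> real ^ 'n ^ 'm \<Rightarrow> real ^ 'n ^ 'm \<Rightarrow> real ^ 'n ^ 'm" where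
  "q_map L Q X = X - (1 / L) *\<^sub>R Q"

end

theory Submission
  imports Defs
begin

text \<open>
  Write \<open>a = q\<^sub>x(Xt)\<close>, \<open>b = q\<^sub>s(St)\<close> and \<open>r = a + b - D\<close>. Completing the square absorbs the linear terms:
  up to a constant the objective is \<open>L/2 (\<parallel>X - a\<parallel>\<^sup>2 + \<parallel>S - b\<parallel>\<^sup>2)\<close>, so the problem is to
  project \<open>(a, b)\<close> onto the convex set \<open>\<parallel>X + S - D\<parallel> \<le> \<delta>\<close>. The constraint sees only the sum of the
  two blocks, so the projection moves both by the same multiple of the residual, to
  \<open>(a - t r, b - t r)\<close>, which leaves the residual \<open>(1 - 2 t) r\<close>. The right \<open>t \<ge> 0\<close> is the one
  for which this point is feasible and either \<open>t = 0\<close> or the constraint is tight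
  (complementary slackness; \<open>t = \<theta> / (L + 2 \<theta>)\<close> for the multiplier \<open>\<theta>\<close>).

  These conditions on \<open>t\<close> suffice for optimality, with a quantitative gap: by Cauchy--Schwarz
  the objective at any feasible point exceeds its value at \<open>(a - t r, b - t r)\<close> by at least
  \<open>L/2\<close> times the squared distance to that point (\<open>projection_gap\<close>). Hence the minimiser exists
  and is unique. Both cases are instances: \<open>t = \<theta> / (L + 2 \<theta>)\<close> for
  \<open>\<delta> > 0\<close>, and its limit \<open>t = 1/2\<close> as \<open>\<theta>\<close> tends to infinity for \<open>\<delta> = 0\<close>.
\<close>

lemma Ps_objective_complete_square:
  fixes X S Xt St Qx Qs :: "real ^ 'n ^ 'm"
  assumes "L > 0"
  shows "Ps_objective L Xt St Qx Qs (X, S) =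
    L / 2 * ((norm (X - q_map L Qx Xt))\<^sup>2 + (norm (S - q_map L Qs St))\<^sup>2)
    + (Qx \<bullet> Xt - Qx \<bullet> Qx / (2 * L) + Qs \<bullet> St - Qs \<bullet> Qs / (2 * L))"
proof -
  have block: "L / 2 * (norm (Y - Z))\<^sup>2 + Q \<bullet> Y
      = L / 2 * (norm (Y - q_map L Q Z))\<^sup>2 + (Q \<bullet> Z - Q \<bullet> Q / (2 * L))"
    for Y Z Q :: "real ^ 'n ^ 'm"
  proof -
    have "Y - q_map L Q Z = (Y - Z) + (1 / L) *\<^sub>R Q"
      by (simp add: q_map_def)
    then have "(norm (Y - q_map L Q Z))\<^sup>2
        = (norm (Y - Z))\<^sup>2 + 2 / L * (Q \<bullet> (Y - Z)) + Q \<bullet> Q / L\<^sup>2"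
      by (simp only: power2_norm_eq_inner)
        (simp add: inner_add_left inner_add_right inner_commute power2_eq_square)
    then show ?thesis
      using assms by (simp add: inner_diff_right field_simps power2_eq_square)
  qed
  show ?thesis
    using block[of X Xt Qx] block[of S St Qs]
    unfolding Ps_objective_def by (simp add: distrib_left)
qed

text \<open>
  The cross terms in the expansion of the squares around \<open>(a - t r, b - t r)\<close> add up to
  \<open>2 t ((1 - 2 t) \<parallel>r\<parallel>\<^sup>2 - w \<bullet> r)\<close> with \<open>w = X + S - D\<close>. If \<open>t \<noteq> 0\<close> the point has residual norm
  \<open>\<delta>\<close>, so \<open>w \<bullet> r \<le> \<delta> \<parallel>r\<parallel> = (1 - 2 t) \<parallel>r\<parallel>\<^sup>2\<close> for every feasible \<open>w\<close>; that is, the cross terms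
  are nonnegative.
\<close>

lemma projection_gap:
  fixes a b D X S :: "'a :: real_inner" and t \<delta> :: real
  defines "r \<equiv> a + b - D"
  assumes "t \<ge> 0"
    and slack: "t = 0 \<or> (1 - 2 * t) * norm r = \<delta>"
    and feasible: "norm (X + S - D) \<le> \<delta>"
  shows "(norm (a - t *\<^sub>R r - a))\<^sup>2 + (norm (b - t *\<^sub>R r - b))\<^sup>2
      + ((norm (X - (a - t *\<^sub>R r)))\<^sup>2 + (norm (S - (b - t *\<^sub>R r)))\<^sup>2)
    \<le> (norm (X - a))\<^sup>2 + (norm (S - b))\<^sup>2"
proof -
  define u where "u = X - (a - t *\<^sub>R r)"
  define v where "v = S - (b - t *\<^sub>R r)"
  have w: "u + v = (X + S - D) - (1 - 2 * t) *\<^sub>R r"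
    by (simp add: u_def v_def r_def algebra_simps flip: scaleR_2)
  have "t * ((X + S - D) \<bullet> r) \<le> t * ((1 - 2 * t) * (r \<bullet> r))"
  proof (cases "t = 0")
    case False
    have "(X + S - D) \<bullet> r \<le> norm (X + S - D) * norm r"
      by (rule norm_cauchy_schwarz)
    also have "\<dots> \<le> \<delta> * norm r"
      using feasible by (simp add: mult_right_mono)
    also have "\<dots> = (1 - 2 * t) * (r \<bullet> r)"
      using slack False by (auto simp: power2_eq_square simp flip: power2_norm_eq_inner)
    finally show ?thesis
      using \<open>t \<ge> 0\<close> by (rule mult_left_mono)
  qed simp
  then have cross: "t * ((u + v) \<bullet> r) \<le> 0"
    unfolding w by (simp add: inner_diff_left right_diff_distrib)
  have "X - a = u - t *\<^sub>R r" "S - b = v - t *\<^sub>R r"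
    by (simp_all add: u_def v_def)
  then have "(norm (X - a))\<^sup>2 + (norm (S - b))\<^sup>2
      = (norm u)\<^sup>2 + (norm v)\<^sup>2 + 2 * (norm (t *\<^sub>R r))\<^sup>2 - 2 * (t * ((u + v) \<bullet> r))"
    by (simp only: power2_norm_eq_inner)
      (simp add: inner_diff_left inner_diff_right inner_add_left inner_commute algebra_simps)
  then show ?thesis
    using cross by (simp flip: u_def v_def)
qed

lemma residual_after_shift:
  fixes a b D :: "'a :: real_vector" and t :: real
  shows "(a - t *\<^sub>R (a + b - D)) + (b - t *\<^sub>R (a + b - D)) - D = (1 - 2 * t) *\<^sub>R (a + b - D)"
  by (simp add: algebra_simps flip: scaleR_2)

lemma Ps_optimal_iff_shifted:
  fixes D Xt St Qx Qs X S :: "real ^ 'n ^ 'm" and L \<delta> t :: real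
  defines "r \<equiv> q_map L Qx Xt + q_map L Qs St - D"
  assumes "L > 0" and "t \<ge> 0"
    and primal: "norm ((1 - 2 * t) *\<^sub>R r) \<le> \<delta>"
    and slack: "t = 0 \<or> (1 - 2 * t) * norm r = \<delta>"
  shows "Ps_optimal D \<delta> L Xt St Qx Qs X S \<longleftrightarrow>
    X = q_map L Qx Xt - t *\<^sub>R r \<and> S = q_map L Qs St - t *\<^sub>R r"
proof -
  define X0 where "X0 = q_map L Qx Xt - t *\<^sub>R r"
  define S0 where "S0 = q_map L Qs St - t *\<^sub>R r"
  let ?f = "Ps_objective L Xt St Qx Qs"
  have gap: "?f (X0, S0) + L / 2 * ((norm (Y - X0))\<^sup>2 + (norm (T - S0))\<^sup>2) \<le> ?f (Y, T)"
    if "Ps_feasible D \<delta> (Y, T)" for Y T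
  proof -
    have "norm (Y + T - D) \<le> \<delta>"
      using that by (simp add: Ps_feasible_def)
    from projection_gap[OF \<open>t \<ge> 0\<close> slack[unfolded r_def] this]
    have "(norm (X0 - q_map L Qx Xt))\<^sup>2 + (norm (S0 - q_map L Qs St))\<^sup>2
        + ((norm (Y - X0))\<^sup>2 + (norm (T - S0))\<^sup>2)
      \<le> (norm (Y - q_map L Qx Xt))\<^sup>2 + (norm (T - q_map L Qs St))\<^sup>2"
      unfolding X0_def S0_def r_def .
    from mult_left_mono[OF this, of "L / 2"] show ?thesis
      using \<open>L > 0\<close> by (simp add: Ps_objective_complete_square distrib_left)
  qed
  have "X0 + S0 - D = (1 - 2 * t) *\<^sub>R r"
    unfolding X0_def S0_def r_def by (rule residual_after_shift)
  then have feasible0: "Ps_feasible D \<delta> (X0, S0)"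
    using primal by (simp add: Ps_feasible_def)
  have minimal0: "?f (X0, S0) \<le> ?f (Y, T)" if "Ps_feasible D \<delta> (Y, T)" for Y T
  proof -
    have "0 \<le> L / 2 * ((norm (Y - X0))\<^sup>2 + (norm (T - S0))\<^sup>2)"
      using \<open>L > 0\<close> by simp
    then show ?thesis
      using gap[OF that] by linarith
  qed
  have "X = X0 \<and> S = S0" if opt: "Ps_optimal D \<delta> L Xt St Qx Qs X S"
  proof -
    have "Ps_feasible D \<delta> (X, S)" and "?f (X, S) \<le> ?f (X0, S0)"
      using opt feasible0 by (auto simp: Ps_optimal_def is_arg_min_linorder)
    with gap[of X S] have "L / 2 * ((norm (X - X0))\<^sup>2 + (norm (S - S0))\<^sup>2) \<le> 0"
      by linarith
    then have "(norm (X - X0))\<^sup>2 + (norm (S - S0))\<^sup>2 \<le> 0"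
      using \<open>L > 0\<close> by (simp add: mult_le_0_iff)
    then show ?thesis
      by (simp add: sum_power2_le_zero_iff)
  qed
  moreover have "Ps_optimal D \<delta> L Xt St Qx Qs X0 S0"
    using feasible0 minimal0 by (auto simp: Ps_optimal_def is_arg_min_linorder)
  ultimately show ?thesis
    unfolding X0_def S0_def by blast
qed

text \<open>
  With \<open>t = \<theta> / (L + 2 \<theta>)\<close> the residual factor is \<open>1 - 2 t = L / (L + 2 \<theta>)\<close>. The multiplier is
  chosen so that \<open>L + 2 \<theta>\<close> is the larger of \<open>L\<close> and \<open>L \<rho> / \<delta>\<close>; the shrunken residual norm is then
  the smaller of \<open>\<rho>\<close> and \<open>\<delta>\<close>.
\<close>

lemma multiplier_KKT:
  fixes L \<delta> \<rho> :: real
  defines "\<theta> \<equiv> max 0 (L / 2 * (\<rho> / \<delta> - 1))"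
  defines "t \<equiv> \<theta> / (L + 2 * \<theta>)"
  assumes "L > 0" and "\<delta> > 0"
  shows "t \<ge> 0" and "0 \<le> 1 - 2 * t" and "(1 - 2 * t) * \<rho> \<le> \<delta>"
    and "t = 0 \<or> (1 - 2 * t) * \<rho> = \<delta>"
proof -
  have "\<theta> \<ge> 0"
    by (simp add: \<theta>_def)
  then have factor: "1 - 2 * t = L / (L + 2 * \<theta>)"
    using \<open>L > 0\<close> by (simp add: t_def field_simps)
  show "t \<ge> 0" "0 \<le> 1 - 2 * t"
    using \<open>\<theta> \<ge> 0\<close> \<open>L > 0\<close> by (simp add: t_def, simp add: factor)
  have "(1 - 2 * t) * \<rho> \<le> \<delta> \<and> (t = 0 \<or> (1 - 2 * t) * \<rho> = \<delta>)"
  proof (cases "\<rho> \<le> \<delta>")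
    case True
    then have "L / 2 * (\<rho> / \<delta> - 1) \<le> 0"
      using \<open>L > 0\<close> \<open>\<delta> > 0\<close> by (simp add: mult_le_0_iff)
    then have "\<theta> = 0"
      by (simp add: \<theta>_def)
    then show ?thesis
      using True by (simp add: t_def)
  next
    case False
    then have "0 \<le> L / 2 * (\<rho> / \<delta> - 1)"
      using \<open>L > 0\<close> \<open>\<delta> > 0\<close> by simp
    then have "L + 2 * \<theta> = L * \<rho> / \<delta>"
      by (simp add: \<theta>_def right_diff_distrib)
    then have "(1 - 2 * t) * \<rho> = \<delta>"
      using False \<open>L > 0\<close> \<open>\<delta> > 0\<close> by (simp add: factor)
    then show ?thesis
      by simp
  qed
  then show "(1 - 2 * t) * \<rho> \<le> \<delta>" "t = 0 \<or> (1 - 2 * t) * \<rho> = \<delta>"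
    by blast+
qed

lemma shift_eq_convex_combination:
  fixes a b D :: "'a :: real_vector" and s t :: real
  assumes "s = 1 - t"
  shows "a - t *\<^sub>R (a + b - D) = t *\<^sub>R (D - b) + s *\<^sub>R a"
    and "b - t *\<^sub>R (a + b - D) = t *\<^sub>R (D - a) + s *\<^sub>R b"
  by (simp_all add: assms algebra_simps)

theorem lemma2p1:
  fixes D Xt St Qx Qs :: "real ^ 'n ^ 'm" and L \<delta> :: real
  assumes "L > 0" and "\<delta> \<ge> 0"
  shows "(\<delta> > 0 \<longrightarrow>
      (let \<theta> = max 0 (L / 2 * (norm (q_map L Qx Xt + q_map L Qs St - D) / \<delta> - 1)) in
        \<forall>X S. Ps_optimal D \<delta> L Xt St Qx Qs X S \<longleftrightarrow>
          X = (\<theta> / (L + 2 * \<theta>)) *\<^sub>R (D - q_map L Qs St)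
              + ((L + \<theta>) / (L + 2 * \<theta>)) *\<^sub>R q_map L Qx Xt \<and>
          S = (\<theta> / (L + 2 * \<theta>)) *\<^sub>R (D - q_map L Qx Xt)
              + ((L + \<theta>) / (L + 2 * \<theta>)) *\<^sub>R q_map L Qs St)) \<and>
    (\<delta> = 0 \<longrightarrow>
      (\<forall>X S. Ps_optimal D \<delta> L Xt St Qx Qs X S \<longleftrightarrow>
          X = (1 / 2) *\<^sub>R (D - q_map L Qs St) + (1 / 2) *\<^sub>R q_map L Qx Xt \<and>
          S = (1 / 2) *\<^sub>R (D - q_map L Qx Xt) + (1 / 2) *\<^sub>R q_map L Qs St))"
proof -
  let ?a = "q_map L Qx Xt" and ?b = "q_map L Qs St"
  let ?r = "?a + ?b - D"
  define \<theta> where "\<theta> = max 0 (L / 2 * (norm ?r / \<delta> - 1))"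
  have pos: "Ps_optimal D \<delta> L Xt St Qx Qs X S \<longleftrightarrow>
      X = (\<theta> / (L + 2 * \<theta>)) *\<^sub>R (D - ?b) + ((L + \<theta>) / (L + 2 * \<theta>)) *\<^sub>R ?a \<and>
      S = (\<theta> / (L + 2 * \<theta>)) *\<^sub>R (D - ?a) + ((L + \<theta>) / (L + 2 * \<theta>)) *\<^sub>R ?b"
    if "\<delta> > 0" for X S
  proof -
    let ?t = "\<theta> / (L + 2 * \<theta>)"
    note kkt = multiplier_KKT[OF \<open>L > 0\<close> \<open>\<delta> > 0\<close>, of "norm ?r", folded \<theta>_def]
    have "norm ((1 - 2 * ?t) *\<^sub>R ?r) \<le> \<delta>"
      unfolding norm_scaleR abs_of_nonneg[OF kkt(2)] by (rule kkt(3))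
    note iff = Ps_optimal_iff_shifted[OF \<open>L > 0\<close> kkt(1) this kkt(4)]
    have "\<theta> \<ge> 0"
      by (simp add: \<theta>_def)
    then have "(L + \<theta>) / (L + 2 * \<theta>) = 1 - ?t"
      using \<open>L > 0\<close> by (simp add: field_simps)
    note comb = shift_eq_convex_combination[OF this]
    show ?thesis
      unfolding iff comb ..
  qed
  have zero: "Ps_optimal D \<delta> L Xt St Qx Qs X S \<longleftrightarrow>
      X = (1 / 2) *\<^sub>R (D - ?b) + (1 / 2) *\<^sub>R ?a \<and>
      S = (1 / 2) *\<^sub>R (D - ?a) + (1 / 2) *\<^sub>R ?b"
    if "\<delta> = 0" for X S
  proof -
    have iff: "Ps_optimal D \<delta> L Xt St Qx Qs X S \<longleftrightarrow>
        X = ?a - (1 / 2) *\<^sub>R ?r \<and> S = ?b - (1 / 2) *\<^sub>R ?r"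
      by (rule Ps_optimal_iff_shifted) (use \<open>L > 0\<close> that in simp_all)
    have "(1 / 2 :: real) = 1 - 1 / 2"
      by simp
    note comb = shift_eq_convex_combination[OF this]
    show ?thesis
      unfolding iff comb ..
  qed
  show ?thesis
    using pos zero unfolding Let_def \<theta>_def by blast
qed

end
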